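(* Let $P=\begin{bmatrix} x_0 & y_0\end{bmatrix}^{\mathrm T}\in\mathbb{R}^2$, let $f$ be a real-valued function defined on a neighborhood $U$ of $P$, put $z_0=f(x_0,y_0)$, and let $p$ be a real number with $0<p<1$. The following two statements are equivalent: 1. The function $f(x,y)$ is totally differentiable at $P$. 2. For arbitrary sequences of points $A_k=\begin{bmatrix} x_k & y_k\end{bmatrix}^{\mathrm T}$ and $B_k=\begin{bmatrix} u_k & v_k\end{bmatrix}^{\mathrm T}$ ($k=1,2,\ldots$) in $U$, all different from $P$, satisfying $$\lim_{k\to\infty}A_k=\lim_{k\to\infty}B_k=P$$ and $$\sin\theta_k\ge p,\qquad k=1,2,\ldots,$$ where $\theta_k$ is the angle between the vectors $A_k-P$ and $B_k-P$, the limit (of a sequence of $1\times 2$ matrices) $$\lim_{k\to\infty}\begin{bmatrix} z_k-z_0 & w_k-z_0\end{bmatrix}\begin{bmatrix} x_k-x_0 & u_k-x_0\\ y_k-y_0 & v_k-y_0\end{bmatrix}^{-1}$$ exists, where $z_k=f(x_k,y_k)$ and $w_k=f(u_k,v_k)$. Moreover, if the statements hold, then for all such sequences the limit in statement 2 equals the total derivative $J$ of $f$ at $P$.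
   Context: $|\cdot|$ denotes the Euclidean length of vectors in $\mathbb{R}^2$ and $\cdot$ the standard inner product. For points $A_k,B_k\neq P$, the angle is $$\theta_k=\arccos\frac{(A_k-P)\cdot(B_k-P)}{|A_k-P|\,|B_k-P|}.$$ (The condition $\sin\theta_k\ge p>0$ ensures that the $2\times 2$ matrix with columns $A_k-P$ and $B_k-P$ is invertible.) The function $f$ is called (totally) differentiable at $P$ if there exists a real $1\times 2$ matrix $J$ such that $$\lim_{\left|\begin{bmatrix}\Delta x & \Delta y\end{bmatrix}^{\mathrm T}\right|\to 0}\frac{\left|\Delta z-J\begin{bmatrix}\Delta x & \Delta y\end{bmatrix}^{\mathrm T}\right|}{\left|\begin{bmatrix}\Delta x & \Delta y\end{bmatrix}^{\mathrm T}\right|}=0,\qquad \Delta z=f(x_0+\Delta x,y_0+\Delta y)-f(x_0,y_0).$$ The matrix $J$ is then called the total derivative (Jacobian matrix) of $f$ at $P$. *)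

theory Defs
  imports "HOL-Analysis.Analysis"
begin

text \<open>
  A \<open>1 \<times> 2\<close> matrix has type \<^typ>\<open>real^2^1\<close> (row index outermost); its product
  with a column vector is a vector of type \<^typ>\<open>real^1\<close>, identified with its only component.
\<close>

definition has_total_derivative :: "(real^2 \<Rightarrow> real) \<Rightarrow> real^2^1 \<Rightarrow> real^2 \<Rightarrow> bool" where
  "has_total_derivative f J P \<longleftrightarrow> (f has_derivative (\<lambda>h. (J *v h) $ 1)) (at P)"

definition totally_differentiable :: "(real^2 \<Rightarrow> real) \<Rightarrow> real^2 \<Rightarrow> bool" where
  "totally_differentiable f P \<longleftrightarrow> (\<exists>J. has_total_derivative f J P)"

lemma has_total_derivative_iff_limit:
  "has_total_derivative f J P \<longleftrightarrow>
     ((\<lambda>h. \<bar>(f (P + h) - f P) - (J *v h) $ 1\<bar> / norm h) \<longlongrightarrow> 0) (at 0)"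
proof -
  have "bounded_linear (\<lambda>h. (J *v h) $ 1)"
    by (rule bounded_linear_compose[OF bounded_linear_vec_nth matrix_vector_mul_bounded_linear])
  then show ?thesis
    unfolding has_total_derivative_def has_derivative_at by simp
qed

definition vertex_angle :: "real^2 \<Rightarrow> real^2 \<Rightarrow> real^2 \<Rightarrow> real" where
  "vertex_angle P A B = arccos (((A - P) \<bullet> (B - P)) / (norm (A - P) * norm (B - P)))"

definition increment_row :: "(real^2 \<Rightarrow> real) \<Rightarrow> real^2 \<Rightarrow> real^2 \<Rightarrow> real^2 \<Rightarrow> real^2^1" where
  "increment_row f P A B = vector [vector [f A - f P, f B - f P]]"

definition displacement_matrix :: "real^2 \<Rightarrow> real^2 \<Rightarrow> real^2 \<Rightarrow> real^2^2" where
  "displacement_matrix P A B =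
     vector [vector [A $ 1 - P $ 1, B $ 1 - P $ 1],
             vector [A $ 2 - P $ 2, B $ 2 - P $ 2]]"

definition difference_quotient :: "(real^2 \<Rightarrow> real) \<Rightarrow> real^2 \<Rightarrow> real^2 \<Rightarrow> real^2 \<Rightarrow> real^2^1" where
  "difference_quotient f P A B = increment_row f P A B ** matrix_inv (displacement_matrix P A B)"

definition admissible_sequences ::
  "(real^2) set \<Rightarrow> real^2 \<Rightarrow> real \<Rightarrow> (nat \<Rightarrow> real^2) \<Rightarrow> (nat \<Rightarrow> real^2) \<Rightarrow> bool" where
  "admissible_sequences U P p A B \<longleftrightarrow>
     (\<forall>k. A k \<in> U \<and> A k \<noteq> P \<and> B k \<in> U \<and> B k \<noteq> P) \<and>
     A \<longlonglongrightarrow> P \<and> B \<longlonglongrightarrow> P \<and>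
     (\<forall>k. sin (vertex_angle P (A k) (B k)) \<ge> p)"

end

theory Submission
  imports Defs
begin

text \<open>
  With \<open>a = A - P\<close>, \<open>b = B - P\<close>, the difference quotient is the matrix \<open>Q\<close> with
  \<open>Q a = f A - f P\<close> and \<open>Q b = f B - f P\<close>.  If \<open>J\<close> is the total derivative, Cramer's rule
  expresses the entries of \<open>Q - J\<close> by the remainders of \<open>f\<close> at \<open>a\<close> and \<open>b\<close> over
  \<open>det [a b] = \<plusminus> |a| |b| sin \<theta>\<close>, hence bounds them by \<open>(|r a| / |a| + |r b| / |b|) / p\<close>.
  Conversely it suffices to use pairs \<open>a\<close>, \<open>b\<close> where \<open>b\<close> is \<open>a\<close> rotated by a right angle:
  interleaving two sequences shows that all limits agree, so \<open>Q\<close> tends to a fixed \<open>J\<close>, and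
  the remainder \<open>(Q - J) a\<close> is \<open>o(|a|)\<close>.
\<close>

text \<open>Fix one sequence \<open>X\<close> and its limit \<open>l\<close>. Interleaving
  \<open>X\<close> with any other \<open>Y\<close> gives a sequence \<open>Z\<close> along which
  \<open>g\<close> converges by assumption; its even and odd subsequences force \<open>Y\<close> to
  share the limit \<open>l\<close>.\<close>

lemma exists_limit_if_all_sequences_convergent:
  fixes g :: "'a::first_countable_topology \<Rightarrow> 'b::t2_space"
  assumes conv: "\<And>X. (\<forall>i. X i \<in> S - {a}) \<Longrightarrow> X \<longlonglongrightarrow> a \<Longrightarrow> convergent (\<lambda>i. g (X i))"
  shows "\<exists>l. (g \<longlongrightarrow> l) (at a within S)"
proof (cases "\<exists>X. (\<forall>i::nat. X i \<in> S - {a}) \<and> X \<longlonglongrightarrow> a")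
  \<comment> \<open>No sequence in \<open>S - {a}\<close> tends to \<open>a\<close>, so every
    \<open>l\<close> is a limit vacuously.\<close>
  case False
  then show ?thesis
    unfolding tendsto_at_iff_sequentially by blast
next
  case True
  then obtain X where X: "\<forall>i::nat. X i \<in> S - {a}" "X \<longlonglongrightarrow> a" by blast
  obtain l where l: "(\<lambda>i. g (X i)) \<longlonglongrightarrow> l"
    using conv[OF X] by (auto simp: convergent_def)
  have "(\<lambda>i. g (Y i)) \<longlonglongrightarrow> l" if Y: "\<forall>i. Y i \<in> S - {a}" "Y \<longlonglongrightarrow> a" for Y
  proof -
    define Z where "Z k = (if even k then X (k div 2) else Y (k div 2))" for k
    have half: "filterlim (\<lambda>k::nat. k div 2) sequentially sequentially"
      by (rule filterlim_at_top_div_const_nat) simp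
    have "Z \<longlonglongrightarrow> a"
      unfolding Z_def
      by (rule filterlim_If)
        (auto intro: tendsto_mono[OF inf_le1] filterlim_compose[OF X(2) half]
          filterlim_compose[OF Y(2) half])
    moreover have "\<forall>i. Z i \<in> S - {a}"
      using X(1) Y(1) by (auto simp: Z_def)
    ultimately obtain m where m: "(\<lambda>i. g (Z i)) \<longlonglongrightarrow> m"
      using conv by (auto simp: convergent_def)
    have "(\<lambda>i. g (Z (2 * i))) \<longlonglongrightarrow> m"
      by (rule filterlim_compose[OF m], rule filterlim_subseq) (simp add: strict_mono_def)
    then have "(\<lambda>i. g (X i)) \<longlonglongrightarrow> m"
      by (simp add: Z_def)
    with l have "m = l"
      by (rule LIMSEQ_unique[symmetric])
    have "(\<lambda>i. g (Z (2 * i + 1))) \<longlonglongrightarrow> m"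
      by (rule filterlim_compose[OF m], rule filterlim_subseq) (simp add: strict_mono_def)
    then show ?thesis
      by (simp add: Z_def \<open>m = l\<close>)
  qed
  then show ?thesis
    unfolding tendsto_at_iff_sequentially comp_def by blast
qed

lemma abs_det_displacement_matrix:
  assumes "A \<noteq> P" "B \<noteq> P"
  shows "\<bar>det (displacement_matrix P A B)\<bar> =
    norm (A - P) * norm (B - P) * sin (vertex_angle P A B)"
proof -
  define a b where "a = A - P" and "b = B - P"
  let ?n = "norm a * norm b" and ?d = "det (displacement_matrix P A B)"
  have pos: "0 < ?n"
    using assms by (simp add: a_def b_def)
  have d: "?d = a $ 1 * b $ 2 - b $ 1 * a $ 2"
    by (simp add: det_2 displacement_matrix_def a_def b_def)
  \<comment> \<open>Cauchy-Schwarz puts the argument of \<open>arccos\<close> into [-1, 1], where it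
    inverts the cosine.\<close>
  have "\<bar>a \<bullet> b\<bar> \<le> ?n"
    by (rule Cauchy_Schwarz_ineq2)
  then have c: "\<bar>(a \<bullet> b) / ?n\<bar> \<le> 1"
    using pos by (simp add: abs_divide)
  have s: "sin (vertex_angle P A B) = sqrt (1 - ((a \<bullet> b) / ?n)\<^sup>2)"
    using c unfolding vertex_angle_def a_def b_def by (simp add: sin_arccos_abs)
  have "?d\<^sup>2 = (a \<bullet> a) * (b \<bullet> b) - (a \<bullet> b)\<^sup>2"
    unfolding d by (simp add: inner_vec_def sum_2 power2_eq_square algebra_simps)
  also have "\<dots> = ?n\<^sup>2 - (a \<bullet> b)\<^sup>2"
    by (simp add: power_mult_distrib power2_norm_eq_inner)
  also have "\<dots> = ?n\<^sup>2 * (1 - ((a \<bullet> b) / ?n)\<^sup>2)"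
    using pos by (simp add: right_diff_distrib power_divide)
  finally have "sqrt (?d\<^sup>2) = sqrt (?n\<^sup>2 * (1 - ((a \<bullet> b) / ?n)\<^sup>2))"
    by simp
  then show ?thesis
    using pos s by (simp add: real_sqrt_mult a_def b_def)
qed

text \<open>Multiplying by the displacement matrix cancels its inverse; the two equations are the
  columns of the resulting identity, since the columns of that matrix are \<open>A - P\<close> and
  \<open>B - P\<close>.\<close>

lemma difference_quotient_mult_displacement:
  assumes "det (displacement_matrix P A B) \<noteq> 0"
  shows "(difference_quotient f P A B *v (A - P)) $ 1 = f A - f P"
    and "(difference_quotient f P A B *v (B - P)) $ 1 = f B - f P"
proof -
  let ?D = "displacement_matrix P A B"
  have "invertible ?D"
    using assms by (simp add: invertible_det_nz)
  then have "matrix_inv ?D ** ?D = mat 1"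
    unfolding invertible_def matrix_inv_def by (rule someI2_ex) blast
  then have "difference_quotient f P A B ** ?D = increment_row f P A B"
    by (simp add: difference_quotient_def matrix_mul_assoc[symmetric])
  then have "(difference_quotient f P A B ** ?D) $ 1 $ i = increment_row f P A B $ 1 $ i" for i
    by simp
  from this[of 1] this[of 2]
  show "(difference_quotient f P A B *v (A - P)) $ 1 = f A - f P"
    and "(difference_quotient f P A B *v (B - P)) $ 1 = f B - f P"
    by (simp_all add: matrix_matrix_mult_def matrix_vector_mult_def sum_2
        displacement_matrix_def increment_row_def)
qed

lemma difference_quotient_error_bound:
  fixes f :: "real^2 \<Rightarrow> real" and J :: "real^2^1" and P :: "real^2"
  defines "r \<equiv> \<lambda>h. \<bar>(f (P + h) - f P) - (J *v h) $ 1\<bar> / norm h"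
  assumes "0 < p" "A \<noteq> P" "B \<noteq> P" "p \<le> sin (vertex_angle P A B)"
  shows "\<bar>(difference_quotient f P A B - J) $ 1 $ j\<bar> \<le> (r (A - P) + r (B - P)) / p"
proof -
  define a b where "a = A - P" and "b = B - P"
  define M where "M = difference_quotient f P A B - J"
  define u v where "u = (M *v a) $ 1" and "v = (M *v b) $ 1"
  define d where "d = det (displacement_matrix P A B)"
  have pos: "0 < norm a" "0 < norm b"
    using assms by (simp_all add: a_def b_def)
  have "p * (norm a * norm b) \<le> sin (vertex_angle P A B) * (norm a * norm b)"
    using assms(5) by (rule mult_right_mono) simp
  then have d_ge: "p * (norm a * norm b) \<le> \<bar>d\<bar>"
    using abs_det_displacement_matrix[OF assms(3,4)] by (simp add: d_def a_def b_def mult.commute)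
  moreover have "0 < p * (norm a * norm b)"
    using pos assms(2) by simp
  ultimately have "d \<noteq> 0"
    by auto
  note Q = difference_quotient_mult_displacement[OF this[unfolded d_def], of f]
  \<comment> \<open>The difference quotient reproduces the increments of \<open>f\<close> exactly,
    so \<open>u\<close> and \<open>v\<close> are the remainders of the linear approximation
    \<open>J\<close> at \<open>a\<close> and \<open>b\<close>.\<close>
  have r: "r a = \<bar>u\<bar> / norm a" "r b = \<bar>v\<bar> / norm b"
    using Q by (simp_all add: r_def u_def v_def M_def a_def b_def matrix_vector_mult_diff_rdistrib)
  \<comment> \<open>Cramer's rule for M [a b] = [u v], cleared of denominators.\<close>
  have M: "M $ 1 $ 1 * d = u * b $ 2 - v * a $ 2" "M $ 1 $ 2 * d = v * a $ 1 - u * b $ 1"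
    by (simp_all add: d_def det_2 displacement_matrix_def u_def v_def a_def b_def
        matrix_vector_mult_def sum_2 algebra_simps)
  have bound: "\<bar>u * b $ i - v * a $ i\<bar> \<le> \<bar>u\<bar> * norm b + \<bar>v\<bar> * norm a" for i
    by (rule order_trans[OF abs_triangle_ineq4])
      (auto simp: abs_mult intro!: add_mono mult_left_mono component_le_norm_cart)
  have "\<bar>M $ 1 $ 1 * d\<bar> \<le> \<bar>u\<bar> * norm b + \<bar>v\<bar> * norm a"
    unfolding M by (rule bound)
  moreover have "\<bar>M $ 1 $ 2 * d\<bar> \<le> \<bar>u\<bar> * norm b + \<bar>v\<bar> * norm a"
    unfolding M abs_minus_commute[of "v * a $ 1"] by (rule bound)
  ultimately have "\<bar>M $ 1 $ j\<bar> * \<bar>d\<bar> \<le> \<bar>u\<bar> * norm b + \<bar>v\<bar> * norm a"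
    using exhaust_2[of j] by (auto simp: abs_mult)
  then have "\<bar>M $ 1 $ j\<bar> * (p * (norm a * norm b)) \<le> \<bar>u\<bar> * norm b + \<bar>v\<bar> * norm a"
    using mult_left_mono[OF d_ge, of "\<bar>M $ 1 $ j\<bar>"] by simp
  then have "\<bar>M $ 1 $ j\<bar> \<le> (r a + r b) / p"
    using pos assms(2) by (simp add: r field_simps)
  then show ?thesis
    by (simp add: M_def a_def b_def)
qed

lemma difference_quotient_tendsto:
  assumes "0 < p" and J: "has_total_derivative f J P" and adm: "admissible_sequences U P p A B"
  shows "(\<lambda>k. difference_quotient f P (A k) (B k)) \<longlonglongrightarrow> J"
proof -
  define r where "r h = \<bar>(f (P + h) - f P) - (J *v h) $ 1\<bar> / norm h" for h
  have r0: "(r \<longlongrightarrow> 0) (at 0)"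
    using J unfolding has_total_derivative_iff_limit r_def .
  \<comment> \<open>The limit \<open>r0\<close> is a punctured one, so the sequence has to avoid
    \<open>P\<close>.\<close>
  have r: "(\<lambda>k. r (X k - P)) \<longlonglongrightarrow> 0" if "X \<longlonglongrightarrow> P" "\<And>k. X k \<noteq> P" for X
  proof (rule filterlim_compose[OF r0])
    show "filterlim (\<lambda>k. X k - P) (at 0) sequentially"
      using that by (simp add: filterlim_at LIM_zero)
  qed
  have bound: "(\<lambda>k. (r (A k - P) + r (B k - P)) / p) \<longlonglongrightarrow> 0"
    using tendsto_divide[OF tendsto_add[OF r[of A] r[of B]] tendsto_const[of p]] adm assms(1)
    by (simp add: admissible_sequences_def)
  have "(\<lambda>k. (difference_quotient f P (A k) (B k) - J) $ 1 $ j) \<longlonglongrightarrow> 0" for j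
    using difference_quotient_error_bound[OF assms(1), of _ P _ f J j] adm
    by (intro Lim_null_comparison[OF _ bound] always_eventually)
      (simp add: admissible_sequences_def r_def)
  then have "(\<lambda>k. difference_quotient f P (A k) (B k) $ 1 $ j - J $ 1 $ j) \<longlonglongrightarrow> 0" for j
    by simp
  then have "\<forall>i. (\<lambda>k. difference_quotient f P (A k) (B k) $ i $ j) \<longlonglongrightarrow> J $ i $ j" for j
    unfolding forall_1 by (rule LIM_zero_cancel)
  then show ?thesis
    by (intro vec_tendstoI) blast
qed

definition rotate_right_angle :: "real^2 \<Rightarrow> real^2" where
  "rotate_right_angle h = vector [- h $ 2, h $ 1]"

lemma norm_rotate_right_angle [simp]: "norm (rotate_right_angle h) = norm h"
  by (simp add: rotate_right_angle_def norm_eq_sqrt_inner inner_vec_def sum_2 add.commute)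

text \<open>The inner product vanishes, so the angle is \<open>arccos 0\<close>. This covers h = 0
  too, because 0 / 0 = 0.\<close>

lemma sin_vertex_angle_rotate [simp]:
  "sin (vertex_angle P (P + h) (P + rotate_right_angle h)) = 1"
  by (simp add: vertex_angle_def rotate_right_angle_def inner_vec_def sum_2)

lemma totally_differentiable_if_convergent:
  assumes "P \<in> interior U" "p < 1"
    and conv: "\<And>A B. admissible_sequences U P p A B \<Longrightarrow>
      convergent (\<lambda>k. difference_quotient f P (A k) (B k))"
  shows "totally_differentiable f P"
proof -
  obtain e where e: "0 < e" "ball P e \<subseteq> U"
    using assms(1) by (meson mem_interior)
  define g where "g h = difference_quotient f P (P + h) (P + rotate_right_angle h)" for h
  \<comment> \<open>Rotation preserves the norm, so both points stay in the ball around
    \<open>P\<close> inside \<open>U\<close> and tend to \<open>P\<close>; the sine is 1, which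
    exceeds \<open>p\<close>.\<close>
  have "convergent (\<lambda>i. g (X i))" if X: "\<forall>i. X i \<in> ball 0 e - {0}" "X \<longlonglongrightarrow> 0" for X
    unfolding g_def
  proof (rule conv)
    have "(\<lambda>k. rotate_right_angle (X k)) \<longlonglongrightarrow> 0"
      by (rule tendsto_norm_zero_cancel) (use tendsto_norm_zero[OF X(2)] in simp)
    moreover have "rotate_right_angle (X k) \<noteq> 0" for k
      using X(1) by (metis Diff_iff norm_rotate_right_angle norm_eq_zero singletonI)
    moreover have "P + h \<in> U" if "norm h < e" for h
      using e(2) that by (auto simp: dist_norm)
    ultimately show "admissible_sequences U P p (\<lambda>i. P + X i) (\<lambda>i. P + rotate_right_angle (X i))"
      using X assms(2) tendsto_add[OF tendsto_const[of P]]
      by (force simp: admissible_sequences_def)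
  qed
  then obtain J where "(g \<longlongrightarrow> J) (at 0 within ball 0 e)"
    using exists_limit_if_all_sequences_convergent by blast
  then have "(g \<longlongrightarrow> J) (at 0)"
    using e(1) at_within_open[of "0 :: real^2" "ball 0 e"] by simp
  then have lim: "((\<lambda>h. norm ((g h - J) $ 1)) \<longlongrightarrow> 0) (at 0)"
    by (intro tendsto_norm_zero) (simp add: LIM_zero_iff tendsto_vec_nth)
  have bound: "\<bar>(f (P + h) - f P) - (J *v h) $ 1\<bar> / norm h \<le> norm ((g h - J) $ 1)"
    if "h \<noteq> 0" for h
  proof -
    have "rotate_right_angle h \<noteq> 0"
      using that by (metis norm_rotate_right_angle norm_eq_zero)
    then have "\<bar>det (displacement_matrix P (P + h) (P + rotate_right_angle h))\<bar> = norm h * norm h"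
      using that by (simp add: abs_det_displacement_matrix)
    then have "det (displacement_matrix P (P + h) (P + rotate_right_angle h)) \<noteq> 0"
      using that by auto
    then have "(g h *v h) $ 1 = f (P + h) - f P"
      using difference_quotient_mult_displacement(1)[of P "P + h" _ f] by (simp add: g_def)
    \<comment> \<open>As \<open>g h\<close> maps \<open>h\<close> to the increment, the remainder is
      the row of \<open>g h - J\<close> applied to \<open>h\<close>; Cauchy-Schwarz then supplies
      the factor \<open>norm h\<close>.\<close>
    then have "(f (P + h) - f P) - (J *v h) $ 1 = ((g h - J) $ 1) \<bullet> h"
      by (simp add: matrix_vector_mul_component inner_diff_left)
    then show ?thesis
      using that Cauchy_Schwarz_ineq2[of "(g h - J) $ 1" h] by (simp add: divide_le_eq)
  qed
  have "((\<lambda>h. \<bar>(f (P + h) - f P) - (J *v h) $ 1\<bar> / norm h) \<longlongrightarrow> 0) (at 0)"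
    by (rule Lim_null_comparison[OF _ lim]) (use bound in \<open>simp add: eventually_at_filter\<close>)
  then show ?thesis
    unfolding totally_differentiable_def has_total_derivative_iff_limit by blast
qed

theorem mainTheorem1:
  fixes f :: "real^2 \<Rightarrow> real" and P :: "real^2" and U :: "(real^2) set" and p :: real
  assumes "P \<in> interior U" and "0 < p" and "p < 1"
  shows "(totally_differentiable f P \<longleftrightarrow>
           (\<forall>A B. admissible_sequences U P p A B \<longrightarrow>
              convergent (\<lambda>k. difference_quotient f P (A k) (B k)))) \<and>
         (\<forall>J. has_total_derivative f J P \<longrightarrow>
           (\<forall>A B. admissible_sequences U P p A B \<longrightarrow>
              (\<lambda>k. difference_quotient f P (A k) (B k)) \<longlonglongrightarrow> J))"
proof (intro conjI iffI allI impI)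
  show "convergent (\<lambda>k. difference_quotient f P (A k) (B k))"
    if "totally_differentiable f P" "admissible_sequences U P p A B" for A B
    using that difference_quotient_tendsto[OF assms(2)]
    unfolding totally_differentiable_def convergent_def by blast
  show "totally_differentiable f P"
    if "\<forall>A B. admissible_sequences U P p A B \<longrightarrow>
      convergent (\<lambda>k. difference_quotient f P (A k) (B k))"
    using totally_differentiable_if_convergent[OF assms(1,3)] that by blast
qed (rule difference_quotient_tendsto[OF assms(2)])

end
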